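(* Let $X\subset\{0,1\}^{\mathbb{N}}$ be the shift space $X=\overline{\bigcup_{n\ge0}X_n}$ defined in the context. Then $(X,\sigma)$ has no DC$3$-pair.
   Context: $\mathbb{N}=\{1,2,\dots\}$; $\{0,1\}^{\mathbb{N}}$ carries the product topology, $\sigma$ is the shift map, $\sigma(x)_i=x_{i+1}$, and the metric is $\rho(x,x)=0$, $\rho(x,y)=2^{-\min\{j\in\mathbb{N}:x_j\ne y_j\}}$ for $x\ne y$. For $x,y\in X$ and $t\in\mathbb{R}$ let $$F_{xy}(t)=\liminf_{n\to\infty}\tfrac1n\left|\{0\le j\le n-1:\rho(\sigma^j(x),\sigma^j(y))<t\}\right|,$$ $$F^*_{xy}(t)=\limsup_{n\to\infty}\tfrac1n\left|\{0\le j\le n-1:\rho(\sigma^j(x),\sigma^j(y))<t\}\right|.$$ A DC$3$-pair is a pair $(x,y)\in X\times X$ such that $F_{xy}(t)<F^*_{xy}(t)$ for all $t$ in some interval of positive length. A shift space is a closed $\sigma$-invariant subset of $\{0,1\}^{\mathbb{N}}$. For blocks, $u^\infty=uuu\dots$, $0^\alpha$ is the block of $\alpha$ zeros ($0^0$ is the empty block), and $\|u\|_1$ is the number of $1$'s in $u$. A block is a from-$1$-to-$1$ word if it equals $1$ or has the form $1v1$ with $v\in\{0,1\}^*$ (possibly empty). For a shift space $Y\subset\{0,1\}^{\mathbb{N}}$, $\mathcal{G}_m(Y)$ is the set of all from-$1$-to-$1$ words $u$ that occur in some point of $Y$ and satisfy $\|u\|_1\le m$. Construction of $X$: let $X_0=\{0^\infty\}\cup\{0^\alpha10^\infty:\alpha\ge0\}$.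 Given $X_n$ ($n\ge0$), let $$P_{n+1}=\bigcup_{l=0}^\infty\sigma^l\big(\{(u0^k)^\infty:k\ge2^{2n},\ u\in\mathcal{G}_{2^n}(X_n)\}\big),$$ $$J'_{n+1}=\{0^\alpha u0^\infty:\alpha\ge0,\ u\in\mathcal{G}_{2^n}(X_n)\},$$ $$J''_{n+1}=\{0^\alpha u0^\beta v0^\infty:\alpha\ge0,\ \beta\ge2^{2n},\ u,v\in\mathcal{G}_{2^n}(X_n)\},$$ $J_{n+1}=J'_{n+1}\cup J''_{n+1}$, $Y_{n+1}=\overline{P_{n+1}\cup J_{n+1}}$, and $X_{n+1}=X_n\cup Y_{n+1}$. Finally $X=\overline{\bigcup_{n=0}^\infty X_n}$. *)

theory Defs
  imports "HOL-Analysis.Analysis" "HOL-Library.Omega_Words_Fun"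
begin

text \<open>
  A point of $\{0,1\}^{\mathbb{N}}$, $\mathbb{N} = \{1,2,\dots\}$, is a function of type
  \<^typ>\<open>nat \<Rightarrow> bool\<close>, where \<^term>\<open>True\<close> is the symbol $1$. Indices start at $0$:
  \<^term>\<open>x i\<close> is the coordinate $x_{i+1}$. The topology is the library's product topology
  on functions, with \<^typ>\<open>bool\<close> discrete. Blocks are lists.
\<close>

definition shift :: "(nat \<Rightarrow> bool) \<Rightarrow> (nat \<Rightarrow> bool)" where
  "shift x = (\<lambda>i. x (Suc i))"

text \<open>\<^term>\<open>Suc\<close> converts the least differing index to the numbering from $1$.\<close>

definition rho :: "(nat \<Rightarrow> bool) \<Rightarrow> (nat \<Rightarrow> bool) \<Rightarrow> real" where
  "rho x y = (if x = y then 0 else (1 / 2) ^ Suc (LEAST i. x i \<noteq> y i))"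

definition visit_freq :: "(nat \<Rightarrow> bool) \<Rightarrow> (nat \<Rightarrow> bool) \<Rightarrow> real \<Rightarrow> nat \<Rightarrow> real" where
  "visit_freq x y t n =
    real (card {j. j < n \<and> rho ((shift ^^ j) x) ((shift ^^ j) y) < t}) / real n"

text \<open>
  \<^const>\<open>liminf\<close> and \<^const>\<open>limsup\<close> need a complete lattice, hence \<^typ>\<open>ereal\<close>; the
  values lie in $[0,1]$.
\<close>

definition lower_distr :: "(nat \<Rightarrow> bool) \<Rightarrow> (nat \<Rightarrow> bool) \<Rightarrow> real \<Rightarrow> ereal" where
  "lower_distr x y t = liminf (\<lambda>n. ereal (visit_freq x y t n))"

definition upper_distr :: "(nat \<Rightarrow> bool) \<Rightarrow> (nat \<Rightarrow> bool) \<Rightarrow> real \<Rightarrow> ereal" where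
  "upper_distr x y t = limsup (\<lambda>n. ereal (visit_freq x y t n))"

text \<open>An interval of positive length may be taken open, by shrinking it.\<close>

definition DC3_pair :: "(nat \<Rightarrow> bool) set \<Rightarrow> (nat \<Rightarrow> bool) \<Rightarrow> (nat \<Rightarrow> bool) \<Rightarrow> bool" where
  "DC3_pair X x y \<longleftrightarrow> x \<in> X \<and> y \<in> X \<and>
    (\<exists>a b. a < b \<and> (\<forall>t\<in>{a<..<b}. lower_distr x y t < upper_distr x y t))"

abbreviation zeros :: "nat \<Rightarrow> bool list" where
  "zeros k \<equiv> replicate k False"

abbreviation zero_seq :: "nat \<Rightarrow> bool" where
  "zero_seq \<equiv> (\<lambda>_. False)"

definition from_1_to_1 :: "bool list \<Rightarrow> bool" where
  "from_1_to_1 u \<longleftrightarrow> u = [True] \<or> (\<exists>v. u = [True] @ v @ [True])"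

definition occurs_in :: "bool list \<Rightarrow> (nat \<Rightarrow> bool) \<Rightarrow> bool" where
  "occurs_in u x \<longleftrightarrow> (\<exists>i j. u = x [i \<rightarrow> j])"

definition G :: "nat \<Rightarrow> (nat \<Rightarrow> bool) set \<Rightarrow> bool list set" where
  "G m Y = {u. from_1_to_1 u \<and> (\<exists>x\<in>Y. occurs_in u x) \<and> count_list u True \<le> m}"

text \<open>
  With \<^term>\<open>A\<close> $= X_n$, the following three sets are $P_{n+1}$, $J'_{n+1}$ and $J''_{n+1}$.
\<close>

definition P_next :: "nat \<Rightarrow> (nat \<Rightarrow> bool) set \<Rightarrow> (nat \<Rightarrow> bool) set" where
  "P_next n A = (\<Union>l. (shift ^^ l) ` {(u @ zeros k)\<^sup>\<omega> | u k. k \<ge> 2 ^ (2 * n) \<and> u \<in> G (2 ^ n) A})"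

definition J1_next :: "nat \<Rightarrow> (nat \<Rightarrow> bool) set \<Rightarrow> (nat \<Rightarrow> bool) set" where
  "J1_next n A = {(zeros \<alpha> @ u) \<frown> zero_seq | \<alpha> u. u \<in> G (2 ^ n) A}"

definition J2_next :: "nat \<Rightarrow> (nat \<Rightarrow> bool) set \<Rightarrow> (nat \<Rightarrow> bool) set" where
  "J2_next n A = {(zeros \<alpha> @ u @ zeros \<beta> @ v) \<frown> zero_seq | \<alpha> \<beta> u v.
    \<beta> \<ge> 2 ^ (2 * n) \<and> u \<in> G (2 ^ n) A \<and> v \<in> G (2 ^ n) A}"

primrec X_stage :: "nat \<Rightarrow> (nat \<Rightarrow> bool) set" where
  "X_stage 0 = {zero_seq} \<union> {(zeros \<alpha> @ [True]) \<frown> zero_seq | \<alpha>. True}"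
| "X_stage (Suc n) = X_stage n \<union>
    closure (P_next n (X_stage n) \<union> (J1_next n (X_stage n) \<union> J2_next n (X_stage n)))"

definition X_limit :: "(nat \<Rightarrow> bool) set" where
  "X_limit = closure (\<Union>n. X_stage n)"

end

(*
  Every point of X is either eventually periodic or has ones of density zero, so up to a set of
  positions of density zero it agrees with an eventually periodic sequence; the visit frequencies of
  two such points therefore converge for every t.

  To see the dichotomy, let x begin with 1 and have infinitely many ones. A from-1-to-1 block of a
  point of P_{m+1} or J_{m+1} of length at most 4^m lies inside a single word of G_{2^m}(X_m), so it
  occurs in X_m and has at most 2^m ones. Hence a from-1-to-1 prefix of x of length L that occurs in
  X_{m+1} but not in X_m has L > 4^m and at most 2^m (L / 4^m + 1) <= 2 L / 2^m ones. If the least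
  stage containing the prefixes of x tends to infinity, the ones of x thus have density zero.
  Otherwise all prefixes occur in one X_m; for the least such m, the long prefixes have too many ones
  for J_m and so are blocks of periodic points of P_m. A period contains a bounded number of ones,
  which bounds its length in terms of x, and so some period works for all of x.
*)
theory Submission
  imports Defs
begin

section \<open>Blocks occurring in the stages\<close>

text \<open>The block is stored as a sequence \<open>x\<close> with a length \<open>N\<close>, so
  that one \<open>x\<close> serves for all its prefixes. Only the values of \<open>x\<close> below
  \<open>N\<close> matter.\<close>

definition prefix_in :: "(nat \<Rightarrow> bool) set \<Rightarrow> (nat \<Rightarrow> bool) \<Rightarrow> nat \<Rightarrow> bool" where
  "prefix_in S x N \<longleftrightarrow> (\<exists>y\<in>S. \<exists>i. \<forall>k<N. y (i + k) = x k)"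

lemma prefix_in_Un: "prefix_in (A \<union> B) x N \<longleftrightarrow> prefix_in A x N \<or> prefix_in B x N"
  by (auto simp: prefix_in_def)

lemma prefix_in_UN: "prefix_in (\<Union>n. A n) x N \<longleftrightarrow> (\<exists>n. prefix_in (A n) x N)"
  by (auto simp: prefix_in_def)

lemma prefix_in_le: "prefix_in S x N \<Longrightarrow> M \<le> N \<Longrightarrow> prefix_in S x M"
  unfolding prefix_in_def by (meson order_less_le_trans)

lemma open_cylinder: "open {z :: nat \<Rightarrow> bool. \<forall>k<M. z k = y k}"
proof -
  have "open ((\<lambda>z :: nat \<Rightarrow> bool. z k) -` {y k})" for k
    by (rule open_vimage[OF open_discrete]) simp
  then have "open (\<Inter>k\<in>{..<M}. (\<lambda>z :: nat \<Rightarrow> bool. z k) -` {y k})"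
    by (intro open_INT) auto
  moreover have "{z. \<forall>k<M. z k = y k} = (\<Inter>k\<in>{..<M}. (\<lambda>z. z k) -` {y k})"
    by auto
  ultimately show ?thesis by simp
qed

text \<open>An occurrence of a block concerns finitely many coordinates and is thus an open
  condition. The closures in the construction therefore add no blocks, and only the generating
  points need to be studied.\<close>

lemma prefix_in_closure: "prefix_in (closure S) x N \<longleftrightarrow> prefix_in S x N"
proof
  assume "prefix_in (closure S) x N"
  then obtain y i where y: "y \<in> closure S" and i: "\<forall>k<N. y (i + k) = x k"
    unfolding prefix_in_def by blast
  have "{z. \<forall>k<i+N. z k = y k} \<inter> closure S \<noteq> {}"
    using y by auto
  then have "{z. \<forall>k<i+N. z k = y k} \<inter> S \<noteq> {}"
    using open_Int_closure_eq_empty[OF open_cylinder] by blast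
  then obtain z where "z \<in> S" "\<forall>k<i+N. z k = y k" by blast
  with i show "prefix_in S x N"
    unfolding prefix_in_def by (intro bexI[of _ z] exI[of _ i]) auto
next
  show "prefix_in S x N \<Longrightarrow> prefix_in (closure S) x N"
    using closure_subset unfolding prefix_in_def by blast
qed

lemma card_ones_eq_count_list: "card {r. r < length u \<and> u ! r} = count_list u True"
  by (simp add: count_list_eq_length_filter length_filter_conv_card)

text \<open>A word of \<open>G M A\<close> is a block of a point of \<open>A\<close> with at most
  \<open>M\<close> ones, and both properties pass to its subblock of length \<open>d + 1\<close>
  starting at \<open>r\<close>.\<close>

lemma G_imp_prefix_in:
  assumes u: "u \<in> G M A" and rd: "r + d < length u"
    and y: "\<forall>e\<le>d. y e = u ! (r + e)"
  shows "prefix_in A y (Suc d)" and "card {e. e \<le> d \<and> y e} \<le> M"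
proof -
  from u obtain z i j where z: "z \<in> A" and ue: "u = subsequence z i j" and c: "count_list u True \<le> M"
    unfolding G_def occurs_in_def by blast
  have "z (i + r + e) = y e" if "e < Suc d" for e
  proof -
    have "r + e < j - i" using ue rd that by simp
    then have "u ! (r + e) = z (i + (r + e))" unfolding ue by simp
    then show ?thesis using y that by (simp add: add.assoc)
  qed
  then show "prefix_in A y (Suc d)"
    unfolding prefix_in_def using z by (intro bexI[of _ z] exI[of _ "i + r"]) auto
  have "card {e. e \<le> d \<and> y e} \<le> card {r. r < length u \<and> u ! r}"
    by (rule card_inj_on_le[of "(+) r"]) (use y rd in auto)
  then show "card {e. e \<le> d \<and> y e} \<le> M"
    using c by (simp add: card_ones_eq_count_list)
qed

lemma G_nonempty: "u \<in> G M A \<Longrightarrow> u \<noteq> []"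
  by (auto simp: G_def from_1_to_1_def)

lemma shift_funpow: "(shift ^^ l) x = suffix l x"
  by (induction l) (auto simp: shift_def suffix_def fun_eq_iff)

section \<open>Coordinate descriptions of the generating points\<close>

lemma P_nextE:
  assumes "y \<in> P_next m A"
  obtains u k l where "u \<in> G (2 ^ m) A" "2 ^ (2 * m) \<le> k"
    "\<And>i. y i \<longleftrightarrow> (i + l) mod (length u + k) < length u \<and> u ! ((i + l) mod (length u + k))"
proof -
  from assms obtain u k l where u: "u \<in> G (2 ^ m) A" and k: "2 ^ (2 * m) \<le> k"
    and y: "y = suffix l ((u @ zeros k)\<^sup>\<omega>)"
    unfolding P_next_def shift_funpow by blast
  have "y i \<longleftrightarrow> (i + l) mod (length u + k) < length u \<and> u ! ((i + l) mod (length u + k))" for i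
  proof -
    define T where "T = length u + k"
    have T: "T > 0" using G_nonempty[OF u] unfolding T_def by simp
    have "y i = (u @ zeros k) ! ((l + i) mod T)"
      using T unfolding y T_def by simp
    moreover have "(l + i) mod T < T" using T by simp
    ultimately show ?thesis
      unfolding T_def[symmetric] by (auto simp: nth_append add.commute T_def split: if_splits)
  qed
  with u k show ?thesis by (rule that)
qed

lemma J1_nextE:
  assumes "y \<in> J1_next m A"
  obtains u a where "u \<in> G (2 ^ m) A"
    "\<And>i. y i \<longleftrightarrow> a \<le> i \<and> i < a + length u \<and> u ! (i - a)"
proof -
  from assms obtain u a where u: "u \<in> G (2 ^ m) A"
    and y: "y = (zeros a @ u) \<frown> zero_seq"
    unfolding J1_next_def by blast
  have "y i \<longleftrightarrow> a \<le> i \<and> i < a + length u \<and> u ! (i - a)" for i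
    unfolding y by (auto simp: conc_def nth_append)
  with u show ?thesis by (rule that)
qed

text \<open>Here \<open>a\<close> and \<open>b\<close> are the starting positions of the two words,
  so the lower bound on the gap becomes an inequality between positions.\<close>

lemma J2_nextE:
  assumes "y \<in> J2_next m A"
  obtains u v a b where "u \<in> G (2 ^ m) A" "v \<in> G (2 ^ m) A" "a + length u + 2 ^ (2 * m) \<le> b"
    "\<And>i. y i \<longleftrightarrow> (a \<le> i \<and> i < a + length u \<and> u ! (i - a)) \<or> (b \<le> i \<and> i < b + length v \<and> v ! (i - b))"
proof -
  from assms obtain u v a k where u: "u \<in> G (2 ^ m) A" and v: "v \<in> G (2 ^ m) A"
    and k: "2 ^ (2 * m) \<le> k"
    and y: "y = (zeros a @ u @ zeros k @ v) \<frown> zero_seq"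
    unfolding J2_next_def by blast
  define b where "b = a + length u + k"
  have "y i \<longleftrightarrow> (a \<le> i \<and> i < a + length u \<and> u ! (i - a)) \<or> (b \<le> i \<and> i < b + length v \<and> v ! (i - b))" for i
    unfolding y b_def by (auto simp: conc_def nth_append)
  moreover have "a + length u + 2 ^ (2 * m) \<le> b" using k unfolding b_def by simp
  ultimately show ?thesis using u v that by blast
qed

section \<open>Ones in short windows and in new blocks\<close>

definition next_set :: "nat \<Rightarrow> (nat \<Rightarrow> bool) set \<Rightarrow> (nat \<Rightarrow> bool) set" where
  "next_set m A = P_next m A \<union> (J1_next m A \<union> J2_next m A)"

text \<open>Different words, or copies of a word, in a generating point are separated by at least
  4^m zeros. Two ones at distance less than 4^m thus lie in the same copy.\<close>

lemma short_block_in_G_word: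
  assumes y: "y \<in> next_set m A" and i: "y i" "y (i + d)" and d: "d < 2 ^ (2 * m)"
  shows "\<exists>u\<in>G (2 ^ m) A. \<exists>r. r + d < length u \<and> (\<forall>e\<le>d. y (i + e) = u ! (r + e))"
proof -
  consider "y \<in> P_next m A" | "y \<in> J1_next m A" | "y \<in> J2_next m A"
    using y unfolding next_set_def by blast
  then show ?thesis
  proof cases
    case 1
    then obtain u k l where u: "u \<in> G (2 ^ m) A" and k: "2 ^ (2 * m) \<le> k"
      and ye: "\<And>i. y i \<longleftrightarrow> (i + l) mod (length u + k) < length u \<and> u ! ((i + l) mod (length u + k))"
      by (rule P_nextE) blast
    define T where "T = length u + k"
    define r where "r = (i + l) mod T"
    have r: "r < length u" using ye i unfolding r_def T_def by blast
    \<comment> \<open>There is no wrap-around: \<open>r < length u\<close> and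
      \<open>e \<le> d < k\<close> give \<open>r + e < T\<close>.\<close>
    have mod: "(i + e + l) mod T = r + e" if "e \<le> d" for e
    proof -
      have "(i + e + l) mod T = (r + e) mod T"
        unfolding r_def mod_add_left_eq by (simp add: ac_simps)
      then show ?thesis using r d k that unfolding T_def by simp
    qed
    \<comment> \<open>Position \<open>r + d\<close> of the period carries a one, so it is not among
      the zeros after \<open>u\<close>.\<close>
    have rd: "r + d < length u"
      using ye[of "i + d"] i mod[of d] unfolding T_def by simp
    moreover have "\<forall>e\<le>d. y (i + e) = u ! (r + e)"
      using ye mod rd unfolding T_def by simp
    ultimately show ?thesis using u by blast
  next
    case 2
    then obtain u a where u: "u \<in> G (2 ^ m) A"
      and ye: "\<And>i. y i \<longleftrightarrow> a \<le> i \<and> i < a + length u \<and> u ! (i - a)"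
      by (rule J1_nextE) blast
    have "i - a + d < length u \<and> (\<forall>e\<le>d. y (i + e) = u ! (i - a + e))"
      using i unfolding ye by auto
    then show ?thesis using u by blast
  next
    case 3
    then obtain u v a b where u: "u \<in> G (2 ^ m) A" "v \<in> G (2 ^ m) A"
      and b: "a + length u + 2 ^ (2 * m) \<le> b"
      and ye: "\<And>i. y i \<longleftrightarrow> (a \<le> i \<and> i < a + length u \<and> u ! (i - a)) \<or> (b \<le> i \<and> i < b + length v \<and> v ! (i - b))"
      by (rule J2_nextE) blast
    show ?thesis
    proof (cases "b \<le> i")
      case True
      then have "i - b + d < length v \<and> (\<forall>e\<le>d. y (i + e) = v ! (i - b + e))"
        using i b unfolding ye by auto
      then show ?thesis using u by blast
    next
      case False
      \<comment> \<open>The one at \<open>i\<close> lies in \<open>u\<close>, so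
        \<open>i + d < a + length u + 2 ^ (2 * m) \<le> b\<close>, and the one at
        \<open>i + d\<close> has not reached \<open>v\<close>.\<close>
      then have "i - a + d < length u \<and> (\<forall>e\<le>d. y (i + e) = u ! (i - a + e))"
        using i b d unfolding ye by auto
      then show ?thesis using u by blast
    qed
  qed
qed

lemma short_block:
  assumes "y \<in> next_set m A" "y i" "y (i + d)" "d < 2 ^ (2 * m)"
  shows "prefix_in A (\<lambda>e. y (i + e)) (Suc d)" and "card {e. e \<le> d \<and> y (i + e)} \<le> 2 ^ m"
proof -
  obtain u r where "u \<in> G (2 ^ m) A" "r + d < length u" "\<forall>e\<le>d. y (i + e) = u ! (r + e)"
    using short_block_in_G_word[OF assms] by blast
  then show "prefix_in A (\<lambda>e. y (i + e)) (Suc d)" "card {e. e \<le> d \<and> y (i + e)} \<le> 2 ^ m"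
    by (rule G_imp_prefix_in)+
qed

text \<open>All ones of the window lie between its first and its last one, and these are less than
  4^m apart, so \<open>short_block\<close> applies to the piece between them.\<close>

lemma window_ones:
  assumes y: "y \<in> next_set m A"
  shows "card {e. e < 2 ^ (2 * m) \<and> y (i + e)} \<le> 2 ^ m"
proof (cases "{e. e < 2 ^ (2 * m) \<and> y (i + e)} = {}")
  case True
  then show ?thesis by (simp only: card.empty)
next
  case False
  define E where "E = {e. e < 2 ^ (2 * m) \<and> y (i + e)}"
  have fin: "finite E" and ne: "E \<noteq> {}" using False unfolding E_def by auto
  define a where "a = Min E"
  define d where "d = Max E - a"
  have "a \<in> E" and b: "Max E \<in> E" unfolding a_def using fin ne by auto
  have "a \<le> Max E" using fin b unfolding a_def by auto
  then have ad: "a + d \<in> E" unfolding d_def using b by simp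
  have "card {e. e \<le> d \<and> y (i + a + e)} \<le> 2 ^ m"
  proof (rule short_block(2)[OF y])
    show "y (i + a)" "y (i + a + d)" "d < 2 ^ (2 * m)"
      using \<open>a \<in> E\<close> ad unfolding E_def by (auto simp: add.assoc)
  qed
  moreover have "E = (+) a ` {e. e \<le> d \<and> y (i + a + e)}"
  proof (intro equalityI subsetI)
    fix e assume e: "e \<in> E"
    then have "a \<le> e" "e \<le> Max E" unfolding a_def using fin by auto
    then have "e = a + (e - a)" "e - a \<le> d" unfolding d_def by auto
    then show "e \<in> (+) a ` {e. e \<le> d \<and> y (i + a + e)}"
      using e unfolding E_def by (intro image_eqI[of _ _ "e - a"]) auto
  next
    fix e assume "e \<in> (+) a ` {e. e \<le> d \<and> y (i + a + e)}"
    then show "e \<in> E" using ad unfolding E_def by (auto simp: add.assoc)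
  qed
  ultimately show ?thesis unfolding E_def[symmetric] by (simp add: card_image)
qed

lemma ones_split: "card {e. e < N + M \<and> z (i + e)} = card {e. e < N \<and> z (i + e)} + card {e. e < M \<and> z (i + N + e)}"
  for i N M :: nat
proof -
  have "{e. e < N + M \<and> z (i + e)} = {e. e < N \<and> z (i + e)} \<union> (+) N ` {e. e < M \<and> z (i + N + e)}"
    (is "?L = ?A \<union> ?B")
  proof (intro equalityI subsetI)
    fix e assume "e \<in> ?L"
    then show "e \<in> ?A \<union> ?B"
      by (cases "e < N") (auto intro!: image_eqI[of _ _ "e - N"])
  qed (auto simp: add.assoc)
  moreover have "card (?A \<union> ?B) = card ?A + card ?B" by (rule card_Un_disjoint) auto
  ultimately show ?thesis by (simp add: card_image)
qed

lemma multi_window_ones: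
  assumes y: "y \<in> next_set m A"
  shows "card {e. e < q * 2 ^ (2 * m) \<and> y (i + e)} \<le> q * 2 ^ m"
proof (induction q)
  case (Suc q)
  have "card {e. e < q * 2 ^ (2 * m) + 2 ^ (2 * m) \<and> y (i + e)} \<le> q * 2 ^ m + 2 ^ m"
    unfolding ones_split using Suc window_ones[OF y] by (rule add_mono)
  then show ?case by (simp add: add.commute)
qed simp

text \<open>With ones at both ends, a block of length at most 4^m would already occur in the
  previous stage, so \<open>N\<close> exceeds 4^m. Now cover the block by \<open>N div M + 1\<close>
  windows of length \<open>M\<close>, each with at most 2^m ones. Since \<open>M\<close> is the
  square of 2^m, multiplying by 2^m turns the bound for a window into its length, and the total
  length of the windows is at most \<open>2 * N\<close>.\<close>

lemma new_prefix_sparse: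
  assumes new: "prefix_in (X_stage (Suc m)) x N" "\<not> prefix_in (X_stage m) x N"
    and x: "N > 0" "x 0" "x (N - 1)"
  shows "card {k. k < N \<and> x k} * 2 ^ m \<le> 2 * N"
proof -
  define M :: nat where "M = 2 ^ (2 * m)"
  have M: "M = 2 ^ m * 2 ^ m" unfolding M_def by (simp add: mult_2 power_add)
  have "prefix_in (next_set m (X_stage m)) x N"
    using new by (simp add: prefix_in_Un prefix_in_closure next_set_def)
  then obtain y i where y: "y \<in> next_set m (X_stage m)" and i: "\<forall>k<N. y (i + k) = x k"
    unfolding prefix_in_def by blast
  have "N - 1 \<ge> M"
  proof (rule ccontr)
    assume "\<not> M \<le> N - 1"
    then have d: "N - 1 < 2 ^ (2 * m)" unfolding M_def by simp
    have "y (i + 0)" "y (i + (N - 1))" using i x by (metis, metis diff_less zero_less_one)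
    then have "prefix_in (X_stage m) (\<lambda>e. y (i + e)) (Suc (N - 1))"
      using short_block(1)[OF y _ _ d] by simp
    then have "prefix_in (X_stage m) x N" using i x unfolding prefix_in_def by auto
    with new show False by blast
  qed
  have "card {k. k < N \<and> x k} \<le> card {k. k < (N div M + 1) * M \<and> y (i + k)}"
  proof (rule card_mono)
    have "N < (N div M + 1) * M"
      using dividend_less_div_times[of M N] unfolding M_def by simp
    then show "{k. k < N \<and> x k} \<subseteq> {k. k < (N div M + 1) * M \<and> y (i + k)}" using i by auto
  qed simp
  also have "\<dots> \<le> (N div M + 1) * 2 ^ m" unfolding M_def by (rule multi_window_ones[OF y])
  finally have "card {k. k < N \<and> x k} * 2 ^ m \<le> (N div M + 1) * 2 ^ m * 2 ^ m" by simp
  also have "\<dots> = (N div M) * M + M" unfolding M by (simp add: algebra_simps)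
  also have "\<dots> \<le> 2 * N"
    using \<open>N - 1 \<ge> M\<close> by (simp add: mult_2 add_mono)
  finally show ?thesis .
qed

section \<open>Bounded stage forces periodicity\<close>

text \<open>A window of length \<open>T\<close> meets every residue modulo \<open>T\<close> once, so
  its ones inject into the ones of \<open>u\<close>.\<close>

lemma P_next_periodic:
  assumes y: "y \<in> P_next m A"
  obtains T where "T > 0" "\<And>i. y (i + T) = y i" "\<And>i. card {e. e < T \<and> y (i + e)} \<le> 2 ^ m"
proof -
  from y obtain u k l where u: "u \<in> G (2 ^ m) A"
    and ye: "\<And>i. y i \<longleftrightarrow> (i + l) mod (length u + k) < length u \<and> u ! ((i + l) mod (length u + k))"
    by (rule P_nextE) blast
  define T where "T = length u + k"
  have T: "T > 0" using G_nonempty[OF u] unfolding T_def by simp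
  moreover have "y (i + T) = y i" for i
  proof -
    have "(i + T + l) mod T = (i + l) mod T"
      by (metis add.assoc add.commute mod_add_self2)
    then show ?thesis unfolding ye[of "i + T"] ye[of i] T_def[symmetric] by simp
  qed
  moreover have "card {e. e < T \<and> y (i + e)} \<le> 2 ^ m" for i
  proof -
    have "card {e. e < T \<and> y (i + e)} \<le> card {r. r < length u \<and> u ! r}"
    proof (rule card_inj_on_le)
      \<comment> \<open>One inequality suffices for injectivity, since the assumptions are symmetric
        in \<open>e\<close> and \<open>f\<close>.\<close>
      have le: "f \<le> e" if "e < T" "f < T" "(i + e + l) mod T = (i + f + l) mod T" for e f
      proof (rule ccontr)
        assume "\<not> f \<le> e"
        with that(3) have "T dvd (i + f + l) - (i + e + l)"
          using mod_eq_dvd_iff_nat[of "i + e + l" "i + f + l" T] by simp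
        with \<open>\<not> f \<le> e\<close> \<open>f < T\<close> show False by (auto dest: dvd_imp_le)
      qed
      have "e = f" if "e < T" "f < T" "(i + e + l) mod T = (i + f + l) mod T" for e f
        using le[of e f] le[of f e] that by simp
      then show "inj_on (\<lambda>e. (i + e + l) mod T) {e. e < T \<and> y (i + e)}"
        unfolding inj_on_def by blast
      show "(\<lambda>e. (i + e + l) mod T) ` {e. e < T \<and> y (i + e)} \<subseteq> {r. r < length u \<and> u ! r}"
        using ye unfolding T_def by auto
    qed simp
    also have "\<dots> \<le> 2 ^ m" using u unfolding card_ones_eq_count_list G_def by simp
    finally show ?thesis .
  qed
  ultimately show ?thesis by (rule that)
qed

lemma ones_block_le: "card {i. (a \<le> i \<and> i < a + length u \<and> u ! (i - a))} \<le> count_list u True"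
proof -
  have "{i. (a \<le> i \<and> i < a + length u \<and> u ! (i - a))} \<subseteq> (+) a ` {r. r < length u \<and> u ! r}"
    by (auto simp: image_iff nat_le_iff_add)
  then show ?thesis
    unfolding card_ones_eq_count_list[symmetric]
    by (intro surj_card_le) auto
qed

text \<open>Such a point contains at most two words of \<open>G\<close>. A block with more ones can
  therefore only come from \<open>P_next\<close>.\<close>

lemma J_next_ones:
  assumes "y \<in> J1_next m A \<union> J2_next m A"
  shows "finite {i. y i} \<and> card {i. y i} \<le> 2 * 2 ^ m"
  using assms
proof
  assume "y \<in> J1_next m A"
  then obtain u a where u: "u \<in> G (2 ^ m) A"
    and ye: "\<And>i. y i \<longleftrightarrow> a \<le> i \<and> i < a + length u \<and> u ! (i - a)"
    by (rule J1_nextE) blast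
  show ?thesis
    using ones_block_le[of a u] u unfolding ye G_def by auto
next
  assume "y \<in> J2_next m A"
  then obtain u v a b where u: "u \<in> G (2 ^ m) A" "v \<in> G (2 ^ m) A"
    and ye: "\<And>i. y i \<longleftrightarrow> (a \<le> i \<and> i < a + length u \<and> u ! (i - a)) \<or> (b \<le> i \<and> i < b + length v \<and> v ! (i - b))"
    by (rule J2_nextE) blast
  have "card {i. y i} \<le> card {i. a \<le> i \<and> i < a + length u \<and> u ! (i - a)}
      + card {i. b \<le> i \<and> i < b + length v \<and> v ! (i - b)}"
    unfolding ye Collect_disj_eq by (rule card_Un_le)
  also have "\<dots> \<le> 2 ^ m + 2 ^ m"
    using ones_block_le[of a u] ones_block_le[of b v] u unfolding G_def
    by (intro add_mono) auto
  finally show ?thesis unfolding ye by auto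
qed

lemma ones_unbounded:
  fixes x :: "nat \<Rightarrow> bool"
  assumes "infinite {i. x i}"
  shows "\<exists>N. card {k. k < N \<and> x k} > c"
proof -
  obtain B where B: "B \<subseteq> {i. x i}" "finite B" "card B = Suc c"
    using infinite_arbitrarily_large[OF assms] by blast
  have "B \<subseteq> {k. k < Suc (Max B) \<and> x k}" using B by (auto simp: less_Suc_eq_le)
  then have "card B \<le> card {k. k < Suc (Max B) \<and> x k}" by (intro card_mono) auto
  then show ?thesis using B by (intro exI[of _ "Suc (Max B)"]) simp
qed

text \<open>Each long prefix has a period of some periodic point. These periods are bounded
  independently of the prefix, so one of them works for all prefixes.\<close>

lemma periodic_if_prefixes_in_next_set:
  assumes inf: "infinite {i. x i}" and pre: "\<And>N. prefix_in (next_set m A) x N"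
  shows "\<exists>T>0. \<forall>i. x (i + T) = x i"
proof -
  \<comment> \<open>This threshold serves twice: it excludes the points of \<open>J1_next\<close>
    and \<open>J2_next\<close>, and it forces \<open>T < B\<close>, because a window of length
    \<open>T\<close> has at most 2^m ones.\<close>
  obtain B where B: "card {k. k < B \<and> x k} > 2 * 2 ^ m" using ones_unbounded[OF inf] by blast
  have per: "\<exists>T>0. T < B \<and> (\<forall>i. i + T < N \<longrightarrow> x (i + T) = x i)" if N: "N \<ge> B" for N
  proof -
    from pre[of N] obtain y j where y: "y \<in> next_set m A" and j: "\<forall>k<N. y (j + k) = x k"
      unfolding prefix_in_def by blast
    have "y \<notin> J1_next m A \<union> J2_next m A"
    proof
      assume "y \<in> J1_next m A \<union> J2_next m A"
      then have "finite {i. y i}" and c: "card {i. y i} \<le> 2 * 2 ^ m" using J_next_ones by auto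
      then have "card {k. k < B \<and> x k} \<le> card {i. y i}"
        using j N by (intro card_inj_on_le[of "(+) j"]) auto
      with B c show False by simp
    qed
    with y have "y \<in> P_next m A" unfolding next_set_def by blast
    then obtain T where T: "T > 0" and p: "\<And>i. y (i + T) = y i"
      and c: "\<And>i. card {e. e < T \<and> y (i + e)} \<le> 2 ^ m" by (rule P_next_periodic) blast
    have "T < B"
    proof (rule ccontr)
      assume "\<not> T < B"
      then have "card {k. k < B \<and> x k} \<le> card {e. e < T \<and> y (j + e)}"
        using j N by (intro card_mono) auto
      with c[of j] B show False by simp
    qed
    moreover have "x (i + T) = x i" if "i + T < N" for i
      using p[of "j + i"] j that by (auto simp: add.assoc)
    ultimately show ?thesis using T by blast
  qed
  show ?thesis
  proof (rule ccontr)
    assume "\<not> ?thesis"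
    then have "\<forall>T. \<exists>i. T > 0 \<longrightarrow> x (i + T) \<noteq> x i" by blast
    then obtain f where f: "\<And>T. T > 0 \<Longrightarrow> x (f T + T) \<noteq> x (f T)" by metis
    \<comment> \<open>If each \<open>T\<close> failed at some \<open>f T\<close>, this
      \<open>N\<close> would lie beyond the failures of all \<open>T < B\<close>; the sum is just a
      convenient upper bound for them.\<close>
    define N where "N = B + (\<Sum>T<B. Suc (f T + T))"
    obtain T where T: "T > 0" "T < B" and q: "\<forall>i. i + T < N \<longrightarrow> x (i + T) = x i"
      using per[of N] unfolding N_def by auto
    have "Suc (f T + T) \<le> (\<Sum>T<B. Suc (f T + T))"
      using T by (intro member_le_sum) auto
    then have "f T + T < N" unfolding N_def by simp
    with q f T show False by blast
  qed
qed

text \<open>The induction descends to the least stage containing all prefixes. Stage 0 is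
  impossible, as its points have at most one 1.\<close>

lemma periodic_if_prefixes_in_stage:
  assumes inf: "infinite {i. x i}" and pre: "\<And>N. prefix_in (X_stage m) x N"
  shows "\<exists>T>0. \<forall>i. x (i + T) = x i"
  using pre
proof (induction m)
  case 0
  obtain B where B: "card {k. k < B \<and> x k} > 1" using ones_unbounded[OF inf] by blast
  obtain y j where y: "y \<in> X_stage 0" and j: "\<forall>k<B. y (j + k) = x k"
    using 0[of B] unfolding prefix_in_def by blast
  have "p = q" if "y p" "y q" for p q
    using y that by (auto simp: conc_def nth_append split: if_splits)
  then have "p = q" if "p < B" "x p" "q < B" "x q" for p q
    using j that by (metis add_left_cancel)
  then have "card {k. k < B \<and> x k} \<le> Suc 0"
    by (subst card_le_Suc0_iff_eq) auto
  with B show ?case by simp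
next
  case (Suc m)
  show ?case
  proof (cases "\<forall>N. prefix_in (X_stage m) x N")
    case True
    then show ?thesis using Suc.IH by blast
  next
    case False
    then obtain N0 where N0: "\<not> prefix_in (X_stage m) x N0" by blast
    have "prefix_in (next_set m (X_stage m)) x N" for N
    proof -
      \<comment> \<open>Prefixes of length at least \<open>N0\<close> are missing from stage
        \<open>m\<close>, so they come from the generators; shorter ones inherit this.\<close>
      have "\<not> prefix_in (X_stage m) x (max N N0)" using N0 prefix_in_le by (metis max.cobounded2)
      then have "prefix_in (next_set m (X_stage m)) x (max N N0)"
        using Suc.prems[of "max N N0"] by (simp add: prefix_in_Un prefix_in_closure next_set_def)
      then show ?thesis by (rule prefix_in_le) simp
    qed
    then show ?thesis by (rule periodic_if_prefixes_in_next_set[OF inf])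
  qed
qed

section \<open>Density\<close>

definition density_zero :: "(nat \<Rightarrow> bool) \<Rightarrow> bool" where
  "density_zero E \<longleftrightarrow> (\<lambda>n. real (card {i. i < n \<and> E i}) / real n) \<longlonglongrightarrow> 0"

text \<open>A common comparison: \<open>C\<close> absorbs boundary effects of translations and
  finite sets, and \<open>K\<close> allows a constant factor.\<close>

lemma density_zero_bound:
  assumes E: "density_zero E"
    and le: "\<And>n. card {i. i < n \<and> F i} \<le> C + K * card {i. i < n \<and> E i}"
  shows "density_zero F"
proof -
  have "(\<lambda>n. real C / real n + real K * (real (card {i. i < n \<and> E i}) / real n)) \<longlonglongrightarrow> 0 + real K * 0"
    using E unfolding density_zero_def
    by (intro tendsto_add tendsto_mult tendsto_const lim_const_over_n)
  then have lim: "(\<lambda>n. real C / real n + real K * (real (card {i. i < n \<and> E i}) / real n)) \<longlonglongrightarrow> 0"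
    by simp
  have "real (card {i. i < n \<and> F i}) / real n
      \<le> real C / real n + real K * (real (card {i. i < n \<and> E i}) / real n)" for n
  proof -
    have "real (card {i. i < n \<and> F i}) \<le> real C + real K * real (card {i. i < n \<and> E i})"
      using le[of n] by (metis of_nat_add of_nat_le_iff of_nat_mult)
    then have "real (card {i. i < n \<and> F i}) / real n
        \<le> (real C + real K * real (card {i. i < n \<and> E i})) / real n"
      by (rule divide_right_mono) simp
    then show ?thesis by (simp add: add_divide_distrib)
  qed
  then show ?thesis
    unfolding density_zero_def
    by (intro tendsto_sandwich[OF _ _ tendsto_const lim]) (auto intro!: always_eventually)
qed

lemma density_zero_False: "density_zero (\<lambda>_. False)"
  by (simp add: density_zero_def)

lemma density_zero_finite:
  assumes "finite {i. E i}"
  shows "density_zero E"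
  by (rule density_zero_bound[OF density_zero_False, where C = "card {i. E i}" and K = 0])
    (use assms in \<open>auto intro: card_mono\<close>)

lemma density_zero_suffix:
  assumes "density_zero (suffix a x)"
  shows "density_zero x"
proof (rule density_zero_bound[OF assms, where C = a and K = 1])
  fix n
  have "card {i. i < n \<and> x i} \<le> card {i. i < a + n \<and> x (0 + i)}" by (rule card_mono) auto
  also have "\<dots> = card {i. i < a \<and> x (0 + i)} + card {i. i < n \<and> x (0 + a + i)}" by (rule ones_split)
  also have "\<dots> \<le> card {..<a} + card {i. i < n \<and> suffix a x i}"
    by (intro add_mono card_mono) auto
  finally show "card {i. i < n \<and> x i} \<le> a + 1 * card {i. i < n \<and> suffix a x i}" by simp
qed

lemma density_zero_disj:
  assumes "density_zero E" "density_zero F"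
  shows "density_zero (\<lambda>i. E i \<or> F i)"
proof -
  have lim: "(\<lambda>n. real (card {i. i < n \<and> E i}) / real n + real (card {i. i < n \<and> F i}) / real n)
      \<longlonglongrightarrow> 0"
    using tendsto_add[OF assms[unfolded density_zero_def]] by simp
  have "real (card {i. i < n \<and> (E i \<or> F i)}) / real n
      \<le> real (card {i. i < n \<and> E i}) / real n + real (card {i. i < n \<and> F i}) / real n" for n
  proof -
    have "{i. i < n \<and> (E i \<or> F i)} = {i. i < n \<and> E i} \<union> {i. i < n \<and> F i}" by auto
    then have "card {i. i < n \<and> (E i \<or> F i)} \<le> card {i. i < n \<and> E i} + card {i. i < n \<and> F i}"
      by (metis card_Un_le)
    then have "real (card {i. i < n \<and> (E i \<or> F i)})
        \<le> real (card {i. i < n \<and> E i}) + real (card {i. i < n \<and> F i})" by linarith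
    then show ?thesis unfolding add_divide_distrib[symmetric] by (rule divide_right_mono) simp
  qed
  then show ?thesis
    unfolding density_zero_def
    by (intro tendsto_sandwich[OF _ _ tendsto_const lim]) (auto intro!: always_eventually)
qed

text \<open>The set is a union of \<open>k\<close> translates of \<open>E\<close>, and translating
  by \<open>d\<close> raises each count by at most \<open>d\<close>. It is needed because the metric
  compares several consecutive coordinates.\<close>

lemma density_zero_thicken:
  assumes "density_zero E"
  shows "density_zero (\<lambda>j. \<exists>d<k. E (j + d))"
proof (induction k)
  case 0
  show ?case by (simp add: density_zero_False)
next
  case (Suc k)
  have "density_zero (\<lambda>j. E (j + k))"
  proof (rule density_zero_bound[OF assms, where C = k and K = 1])
    fix n
    have "card {j. j < n \<and> E (j + k)} \<le> card {i. i < n + k \<and> E (0 + i)}"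
      by (rule card_inj_on_le[of "\<lambda>j. j + k"]) auto
    also have "\<dots> = card {i. i < n \<and> E (0 + i)} + card {i. i < k \<and> E (0 + n + i)}" by (rule ones_split)
    also have "card {i. i < k \<and> E (0 + n + i)} \<le> card {..<k}" by (rule card_mono) auto
    finally show "card {j. j < n \<and> E (j + k)} \<le> k + 1 * card {i. i < n \<and> E i}" by simp
  qed
  from density_zero_disj[OF Suc this] show ?case
    by (simp add: less_Suc_eq conj_disj_distribR ex_disj_distrib)
qed

section \<open>Averages of eventually periodic sequences\<close>

definition eventually_periodic :: "(nat \<Rightarrow> 'a) \<Rightarrow> bool" where
  "eventually_periodic f \<longleftrightarrow> (\<exists>a. \<exists>T>0. \<forall>i\<ge>a. f (i + T) = f i)"

lemma eventually_periodic_multiple: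
  fixes f :: "nat \<Rightarrow> 'a"
  assumes "\<forall>i\<ge>a. f (i + T) = f i" "i \<ge> a"
  shows "f (i + q * T) = f i"
proof (induction q)
  case (Suc q)
  have "f (i + q * T + T) = f (i + q * T)" using assms by simp
  then show ?case using Suc by (simp add: ac_simps)
qed simp

lemma eventually_periodic_Pair:
  assumes "eventually_periodic f" "eventually_periodic g"
  shows "eventually_periodic (\<lambda>i. (f i, g i))"
proof -
  obtain a T where T: "T > 0" "\<forall>i\<ge>a. f (i + T) = f i"
    using assms unfolding eventually_periodic_def by blast
  obtain b S where S: "S > 0" "\<forall>i\<ge>b. g (i + S) = g i"
    using assms unfolding eventually_periodic_def by blast
  have "f (i + S * T) = f i \<and> g (i + S * T) = g i" if "i \<ge> max a b" for i
    using eventually_periodic_multiple[OF T(2), of i S] eventually_periodic_multiple[OF S(2), of i T] that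
    by (simp add: mult.commute)
  then show ?thesis
    unfolding eventually_periodic_def
    using T S by (intro exI[of _ "max a b"] exI[of _ "S * T"]) auto
qed

text \<open>From \<open>a\<close> on, every window of length \<open>T\<close> has the same number
  \<open>w a\<close> of ones. Hence the deviation \<open>g\<close> of the count from its linear
  growth is eventually periodic, thus bounded, and the limit is \<open>w a / T\<close>.\<close>

lemma eventually_periodic_average:
  assumes "eventually_periodic f"
  shows "\<exists>c. (\<lambda>n. real (card {j. j < n \<and> f j}) / real n) \<longlonglongrightarrow> c"
proof -
  obtain a T where T: "T > 0" and p: "\<forall>i\<ge>a. f (i + T) = f i"
    using assms unfolding eventually_periodic_def by blast
  define w where "w n = card {e. e < T \<and> f (n + e)}" for n
  define c where "c n = card {j. j < n \<and> f j}" for n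
  have w: "w n = w a" if "n \<ge> a" for n
    using that
  proof (induction n rule: dec_induct)
    case (step n)
    \<comment> \<open>A window of length \<open>T + 1\<close> is split after its first and before
      its last position; these two positions carry the same value.\<close>
    have "card {e. e < 1 + T \<and> f (n + e)} = card {e. e < T + 1 \<and> f (n + e)}" by simp
    then have "card {e::nat. e < 1 \<and> f (n + e)} + w (n + 1) = w n + card {e::nat. e < 1 \<and> f (n + T + e)}"
      unfolding ones_split w_def .
    moreover have "{e::nat. e < 1 \<and> f (n + T + e)} = {e. e < 1 \<and> f (n + e)}"
      using p step by auto
    ultimately show ?case using step by simp
  qed simp
  have c_step: "c (n + T) = c n + w a" if "n \<ge> a" for n
    unfolding w[OF that, symmetric] using ones_split[of n T f 0] by (simp add: c_def w_def)
  define g where "g n = real (c n) - real n * (real (w a) / real T)" for n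
  have g: "g (n + T) = g n" if "n \<ge> a" for n
    using c_step[OF that] T unfolding g_def by (simp add: field_simps)
  \<comment> \<open>Every later argument of \<open>g\<close> reduces to one below
    \<open>a + T\<close> by subtracting \<open>T\<close>.\<close>
  define B where "B = (\<Sum>n<a+T. \<bar>g n\<bar>)"
  have "\<bar>g n\<bar> \<le> B" for n
  proof (induction n rule: less_induct)
    case (less n)
    show ?case
    proof (cases "n < a + T")
      case True
      then show ?thesis unfolding B_def by (intro member_le_sum) auto
    next
      case False
      then show ?thesis using g[of "n - T"] less[of "n - T"] T by simp
    qed
  qed
  then have "norm (g n / real n) \<le> B / real n" for n
    by (simp add: divide_right_mono)
  then have "(\<lambda>n. g n / real n) \<longlonglongrightarrow> 0"
    by (intro Lim_null_comparison[OF _ lim_const_over_n[of B]] always_eventually) auto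
  then have "(\<lambda>n. g n / real n + real (w a) / real T) \<longlonglongrightarrow> 0 + real (w a) / real T"
    by (intro tendsto_add tendsto_const)
  moreover have "\<forall>\<^sub>F n in sequentially. g n / real n + real (w a) / real T = real (c n) / real n"
    using eventually_gt_at_top[of 0] by eventually_elim (simp add: g_def diff_divide_distrib)
  ultimately show ?thesis unfolding c_def by (blast intro: Lim_transform_eventually)
qed

lemma average_density_zero_change:
  assumes lim: "(\<lambda>n. real (card {j. j < n \<and> f j}) / real n) \<longlonglongrightarrow> c"
    and E: "density_zero E" and eq: "\<And>j. \<not> E j \<Longrightarrow> g j \<longleftrightarrow> f j"
  shows "(\<lambda>n. real (card {j. j < n \<and> g j}) / real n) \<longlonglongrightarrow> c"
proof -
  have le: "card {j. j < n \<and> h j} \<le> card {j. j < n \<and> h' j} + card {j. j < n \<and> E j}"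
    if "\<And>j. \<not> E j \<Longrightarrow> h j \<longleftrightarrow> h' j" for h h' and n :: nat
  proof -
    have "card {j. j < n \<and> h j} \<le> card ({j. j < n \<and> h' j} \<union> {j. j < n \<and> E j})"
      using that by (intro card_mono) auto
    also have "\<dots> \<le> card {j. j < n \<and> h' j} + card {j. j < n \<and> E j}" by (rule card_Un_le)
    finally show ?thesis .
  qed
  have "norm (real (card {j. j < n \<and> g j}) / real n - real (card {j. j < n \<and> f j}) / real n)
      \<le> real (card {j. j < n \<and> E j}) / real n" for n
  proof -
    have "\<bar>real (card {j. j < n \<and> g j}) - real (card {j. j < n \<and> f j})\<bar> \<le> real (card {j. j < n \<and> E j})"
      using le[of g f n] le[of f g n] eq by (auto simp: abs_le_iff)
    then show ?thesis
      by (simp add: diff_divide_distrib[symmetric] divide_right_mono)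
  qed
  then have "(\<lambda>n. real (card {j. j < n \<and> g j}) / real n - real (card {j. j < n \<and> f j}) / real n) \<longlonglongrightarrow> 0"
    by (intro Lim_null_comparison[OF _ E[unfolded density_zero_def]] always_eventually) auto
  from tendsto_add[OF this lim] show ?thesis by simp
qed

section \<open>Points of the limit shift\<close>

lemma X_stage_mono: "m \<le> n \<Longrightarrow> X_stage m \<subseteq> X_stage n"
  by (rule lift_Suc_mono_le) auto

text \<open>Fix \<open>m\<close>. A sufficiently long prefix that ends in a one first occurs at a
  stage \<open>Suc m'\<close> with \<open>m' \<ge> m\<close>, so \<open>new_prefix_sparse\<close>
  bounds its density of ones by 2 / 2^m.\<close>

lemma density_zero_if_stages_unbounded:
  assumes inf: "infinite {i. x i}" and x0: "x 0"
    and pre: "\<And>N. \<exists>n. prefix_in (X_stage n) x N"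
    and unb: "\<And>m. \<exists>N. \<not> prefix_in (X_stage m) x N"
  shows "density_zero x"
proof -
  have sparse: "\<exists>N0. \<forall>N\<ge>N0. card {k. k < N \<and> x k} * 2 ^ m \<le> 2 * N" for m
  proof -
    obtain N0 where N0: "\<not> prefix_in (X_stage m) x N0" using unb by blast
    \<comment> \<open>A one at or beyond \<open>N0\<close> ensures that the last one before
      \<open>N\<close> is late enough for its prefix to be missing from stage
      \<open>m\<close>.\<close>
    obtain p where p: "p \<ge> N0" "x p" using inf unfolding infinite_nat_iff_unbounded_le by auto
    have "card {k. k < N \<and> x k} * 2 ^ m \<le> 2 * N" if N: "N \<ge> Suc p" for N
    proof -
      \<comment> \<open>Cutting the prefix after its last one loses no ones and provides the final
        one that \<open>new_prefix_sparse\<close> requires.\<close>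
      define q where "q = Max {k. k < N \<and> x k}"
      have pN: "p \<in> {k. k < N \<and> x k}" using p N by auto
      then have "q \<in> {k. k < N \<and> x k}" unfolding q_def by (intro Max_in) auto
      then have q: "q < N" "x q" by auto
      have max: "k \<le> q" if "k < N" "x k" for k
        unfolding q_def using that by (intro Max_ge) auto
      have "p \<le> q" using pN max by simp
      define n where "n = (LEAST n. prefix_in (X_stage n) x (Suc q))"
      have n: "prefix_in (X_stage n) x (Suc q)"
        unfolding n_def using pre[of "Suc q"] by (rule LeastI_ex)
      have nmin: "\<not> prefix_in (X_stage n') x (Suc q)" if "n' < n" for n'
        using that not_less_Least unfolding n_def by blast
      have nm: "\<not> n \<le> m"
      proof
        assume "n \<le> m"
        then have "prefix_in (X_stage m) x (Suc q)"
          using n X_stage_mono unfolding prefix_in_def by blast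
        then show False using N0 p \<open>p \<le> q\<close> prefix_in_le[of _ x "Suc q" N0] by simp
      qed
      then obtain m' where m': "n = Suc m'" "m \<le> m'" by (cases n) auto
      have "card {k. k < Suc q \<and> x k} * 2 ^ m' \<le> 2 * Suc q"
        using n nmin[of m'] q x0 unfolding m' by (intro new_prefix_sparse) auto
      moreover have "{k. k < N \<and> x k} = {k. k < Suc q \<and> x k}"
        using max q by (auto simp: less_Suc_eq_le)
      moreover have "card {k. k < Suc q \<and> x k} * 2 ^ m \<le> card {k. k < Suc q \<and> x k} * 2 ^ m'"
        using m' by (intro mult_left_mono power_increasing) auto
      moreover have "2 * Suc q \<le> 2 * N" using q by simp
      ultimately show ?thesis by (metis le_trans)
    qed
    then show ?thesis by blast
  qed
  show ?thesis unfolding density_zero_def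
  proof (rule LIMSEQ_I)
    fix r :: real assume r: "r > 0"
    obtain m where m: "(1 / 2) ^ m < r / 2" using real_arch_pow_inv[of "r / 2" "1 / 2"] r by auto
    obtain N0 where N0: "\<And>N. N \<ge> N0 \<Longrightarrow> card {k. k < N \<and> x k} * 2 ^ m \<le> 2 * N" using sparse by blast
    show "\<exists>no. \<forall>n\<ge>no. norm (real (card {i. i < n \<and> x i}) / real n - 0) < r"
    proof (intro exI allI impI)
      fix n assume n: "n \<ge> Suc N0"
      have "real (card {k. k < n \<and> x k}) * 2 ^ m \<le> 2 * real n"
        using N0[of n] n of_nat_mono[of "card {k. k < n \<and> x k} * 2 ^ m" "2 * n", where 'a = real] by simp
      then have "real (card {k. k < n \<and> x k}) / real n \<le> 2 * (1 / 2) ^ m"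
        using n by (simp add: field_simps power_divide)
      with m show "norm (real (card {i. i < n \<and> x i}) / real n - 0) < r" by simp
    qed
  qed
qed

lemma periodic_or_sparse:
  assumes "x \<in> X_limit"
  shows "eventually_periodic x \<or> density_zero x"
proof (cases "finite {i. x i}")
  case True
  then show ?thesis using density_zero_finite by blast
next
  case inf: False
  \<comment> \<open>Starting the suffix at a one provides the initial one required in the sparse
    case.\<close>
  then obtain a where a: "x a" by fastforce
  have pre: "\<exists>n. prefix_in (X_stage n) (suffix a x) N" for N
  proof -
    have "prefix_in X_limit (suffix a x) N"
      using assms unfolding prefix_in_def by (intro bexI[of _ x] exI[of _ a]) auto
    then show ?thesis unfolding X_limit_def prefix_in_closure prefix_in_UN .
  qed
  have inf': "infinite {i. suffix a x i}"
  proof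
    assume "finite {i. suffix a x i}"
    then have "finite ({..<a} \<union> (+) a ` {i. suffix a x i})" by simp
    moreover have "{i. x i} \<subseteq> {..<a} \<union> (+) a ` {i. suffix a x i}"
    proof
      fix i assume "i \<in> {i. x i}"
      then show "i \<in> {..<a} \<union> (+) a ` {i. suffix a x i}"
        by (cases "i < a") (auto intro!: image_eqI[of _ _ "i - a"])
    qed
    ultimately show False using inf finite_subset by blast
  qed
  show ?thesis
  proof (cases "\<exists>m. \<forall>N. prefix_in (X_stage m) (suffix a x) N")
    case True
    then obtain T where T: "T > 0" "\<And>i. suffix a x (i + T) = suffix a x i"
      using periodic_if_prefixes_in_stage[OF inf'] by blast
    have "x (i + T) = x i" if "i \<ge> a" for i
      using T(2)[of "i - a"] that by simp
    then show ?thesis unfolding eventually_periodic_def using T by blast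
  next
    case False
    then have "density_zero (suffix a x)"
      using a by (intro density_zero_if_stages_unbounded[OF inf' _ pre]) auto
    then show ?thesis using density_zero_suffix by blast
  qed
qed

text \<open>This merges the two alternatives, with \<open>p\<close> either \<open>x\<close> itself
  or \<open>zero_seq\<close>, so that pairs of points need no case distinction.\<close>

lemma eventually_periodic_approx:
  assumes "x \<in> X_limit"
  shows "\<exists>p. eventually_periodic p \<and> density_zero (\<lambda>i. x i \<noteq> p i)"
  using periodic_or_sparse[OF assms]
proof
  assume "eventually_periodic x"
  then show ?thesis using density_zero_False by (intro exI[of _ x]) simp
next
  assume "density_zero x"
  moreover have "eventually_periodic zero_seq" unfolding eventually_periodic_def by auto
  ultimately show ?thesis by (intro exI[of _ zero_seq]) simp
qed

section \<open>Visit frequencies of pairs\<close>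

text \<open>If \<open>L\<close> is the least differing index, then \<open>rho x y\<close> is
  \<open>(1 / 2) ^ Suc L\<close>. So \<open>k\<close> is the least index with
  \<open>(1 / 2) ^ Suc k < t\<close>, the same for all \<open>x\<close> and
  \<open>y\<close>.\<close>

lemma rho_less_iff_agree:
  assumes "t > 0"
  shows "\<exists>k. \<forall>x y. rho x y < t \<longleftrightarrow> (\<forall>d<k. x d = y d)"
proof -
  define k where "k = (LEAST i. (1 / 2) ^ Suc i < t)"
  obtain n where "(1 / 2) ^ n < t" using real_arch_pow_inv[of t "1 / 2"] assms by auto
  moreover have "(1 / 2 :: real) ^ Suc n \<le> (1 / 2) ^ n" by (intro power_decreasing) auto
  ultimately have k: "(1 / 2) ^ Suc k < t"
    unfolding k_def by (intro LeastI[of "\<lambda>i. (1 / 2) ^ Suc i < t" n]) (rule le_less_trans)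
  have kiff: "(1 / 2) ^ Suc i < t \<longleftrightarrow> k \<le> i" for i
  proof
    assume "k \<le> i"
    then have "(1 / 2 :: real) ^ Suc i \<le> (1 / 2) ^ Suc k" by (intro power_decreasing) auto
    then show "(1 / 2) ^ Suc i < t" using k by (rule le_less_trans)
  qed (auto simp: k_def intro: Least_le)
  have "rho x y < t \<longleftrightarrow> (\<forall>d<k. x d = y d)" for x y
  proof (cases "x = y")
    case True
    then show ?thesis using assms by (simp add: rho_def)
  next
    case False
    define L where "L = (LEAST i. x i \<noteq> y i)"
    from False have "\<exists>i. x i \<noteq> y i" by auto
    then have L: "x L \<noteq> y L" unfolding L_def by (rule LeastI_ex)
    have "rho x y < t \<longleftrightarrow> k \<le> L" using False kiff unfolding rho_def L_def by simp
    also have "\<dots> \<longleftrightarrow> (\<forall>d<k. x d = y d)"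
    proof
      assume "k \<le> L"
      then show "\<forall>d<k. x d = y d"
        using not_less_Least[of _ "\<lambda>i. x i \<noteq> y i"] unfolding L_def[symmetric] by auto
    qed (use L in \<open>auto simp: not_less[symmetric]\<close>)
    finally show ?thesis .
  qed
  then show ?thesis by blast
qed

text \<open>For \<open>t > 0\<close> the visit condition at time \<open>j\<close> concerns
  \<open>k\<close> coordinates from \<open>j\<close> on. Replacing \<open>x\<close> and
  \<open>y\<close> by \<open>p\<close> and \<open>q\<close> changes it only on a set of density zero
  and makes it eventually periodic in \<open>j\<close>. For other \<open>t\<close> there are no
  visits.\<close>

lemma visit_freq_convergent:
  assumes x: "x \<in> X_limit" and y: "y \<in> X_limit"
  shows "\<exists>c. visit_freq x y t \<longlonglongrightarrow> c"
proof (cases "t > 0")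
  case False
  have "rho u v \<ge> 0" for u v unfolding rho_def by simp
  with False have "\<not> rho u v < t" for u v by (meson not_less order_trans)
  then have "visit_freq x y t = (\<lambda>_. 0)" unfolding visit_freq_def by auto
  then show ?thesis by auto
next
  case True
  obtain k where k: "\<And>u v. rho u v < t \<longleftrightarrow> (\<forall>d<k. u d = v d)"
    using rho_less_iff_agree[OF True] by blast
  obtain p where p: "eventually_periodic p" "density_zero (\<lambda>i. x i \<noteq> p i)"
    using eventually_periodic_approx[OF x] by blast
  obtain q where q: "eventually_periodic q" "density_zero (\<lambda>i. y i \<noteq> q i)"
    using eventually_periodic_approx[OF y] by blast
  let ?f = "\<lambda>j. \<forall>d<k. p (j + d) = q (j + d)"
  obtain a T where T: "T > 0" "\<forall>i\<ge>a. (p (i + T), q (i + T)) = (p i, q i)"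
    using eventually_periodic_Pair[OF p(1) q(1)] unfolding eventually_periodic_def by blast
  have "?f (i + T) = ?f i" if "i \<ge> a" for i
  proof -
    have "p (i + T + d) = p (i + d)" "q (i + T + d) = q (i + d)" for d
      using T(2)[rule_format, of "i + d"] that by (auto simp: ac_simps)
    then show ?thesis by simp
  qed
  then have "eventually_periodic ?f" unfolding eventually_periodic_def using T(1) by blast
  then obtain c where c: "(\<lambda>n. real (card {j. j < n \<and> ?f j}) / real n) \<longlonglongrightarrow> c"
    using eventually_periodic_average by blast
  have E: "density_zero (\<lambda>j. \<exists>d<k. x (j + d) \<noteq> p (j + d) \<or> y (j + d) \<noteq> q (j + d))"
    by (rule density_zero_thicken[OF density_zero_disj[OF p(2) q(2)]])
  have "(\<lambda>n. real (card {j. j < n \<and> rho ((shift ^^ j) x) ((shift ^^ j) y) < t}) / real n) \<longlonglongrightarrow> c"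
    by (rule average_density_zero_change[OF c E]) (auto simp: k shift_funpow)
  then show ?thesis unfolding visit_freq_def by blast
qed

theorem lemma10:
  shows "\<not> (\<exists>x y. DC3_pair X_limit x y)"
proof
  assume "\<exists>x y. DC3_pair X_limit x y"
  then obtain x y a b where xy: "x \<in> X_limit" "y \<in> X_limit" and ab: "a < b"
    and less: "\<forall>t\<in>{a<..<b}. lower_distr x y t < upper_distr x y t"
    unfolding DC3_pair_def by blast
  \<comment> \<open>A single \<open>t\<close> suffices, since convergence makes the two distribution
    functions agree there.\<close>
  obtain t where t: "t \<in> {a<..<b}" using dense[OF ab] by auto
  obtain c where "visit_freq x y t \<longlonglongrightarrow> c" using visit_freq_convergent[OF xy] by blast
  then have "(\<lambda>n. ereal (visit_freq x y t n)) \<longlonglongrightarrow> ereal c" by simp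
  then have "lower_distr x y t = upper_distr x y t"
    unfolding lower_distr_def upper_distr_def
    using lim_imp_Liminf lim_imp_Limsup trivial_limit_sequentially by metis
  with less t show False by (metis less_irrefl)
qed

end
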